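(* Let $0<\alpha\le1$, $t_0\in\mathbb{R}$, $R>0$, and let $f:[t_0,t_0+R)\to\mathbb{R}$ be infinitely $\alpha$-differentiable and have the fractional power series representation $$f(t)=\sum_{k=0}^\infty \frac{(T_\alpha^{t_0}f)^{(k)}(t_0)\,(t-t_0)^{k\alpha}}{\alpha^k k!},\qquad t_0<t<t_0+R .$$ Suppose that for some $n\in\mathbb{N}$ and some $M>0$ we have $|(T_\alpha^{t_0} f)^{(n+1)}(t)|\le M$ for all $t\in(t_0,t_0+R)$. Then for all $t\in(t_0,t_0+R)$ $$|R_n^\alpha(t)|\le \frac{M}{\alpha^{n+1}(n+1)!}(t-t_0)^{\alpha(n+1)},$$ where $$R_n^\alpha(t)=\sum_{k=n+1}^\infty \frac{(T_\alpha^{t_0}f)^{(k)}(t_0)(t-t_0)^{k\alpha}}{\alpha^k k!}=f(t)-\sum_{k=0}^n \frac{(T_\alpha^{t_0}f)^{(k)}(t_0)(t-t_0)^{k\alpha}}{\alpha^k k!}.$$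
   Context: For $0<\alpha\le1$, the left conformable fractional derivative of order $\alpha$ starting from $t_0$ of $f$ at $t>t_0$ is $$(T_\alpha^{t_0} f)(t)=\lim_{\epsilon\to0}\frac{f(t+\epsilon (t-t_0)^{1-\alpha})-f(t)}{\epsilon},$$ and $(T_\alpha^{t_0} f)(t_0)=\lim_{t\to t_0^+}(T_\alpha^{t_0} f)(t)$. $(T_\alpha^{t_0}f)^{(k)}$ denotes the result of applying $T_\alpha^{t_0}$ to $f$ successively $k$ times (with $(T_\alpha^{t_0}f)^{(0)}=f$). $f$ is infinitely $\alpha$-differentiable on $[t_0,t_0+R)$ if all these iterated derivatives exist at every point of $[t_0,t_0+R)$ (at $t_0$ as the limit just described). *)

theory Defs
  imports Complex_Main
begin

definition conf_quot :: "real \<Rightarrow> real \<Rightarrow> (real \<Rightarrow> real) \<Rightarrow> real \<Rightarrow> real \<Rightarrow> real" where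
  "conf_quot \<alpha> t0 f t \<epsilon> = (f (t + \<epsilon> * (t - t0) powr (1 - \<alpha>)) - f t) / \<epsilon>"

text \<open>The left conformable derivative from \<open>t0\<close>. Its values are meaningful only at points
  \<open>t \<ge> t0\<close> where \<open>conf_differentiable\<close> (below) holds, since \<open>Lim\<close> is unspecified
  for functions without a limit. A function on \<open>[t0, t0 + R)\<close> is represented by a total function;
  the values at points of \<open>[t0, t0 + R)\<close> do not depend on the choice of extension, because
  the limits are local and one-sided at \<open>t0\<close>.\<close>

definition conf_deriv :: "real \<Rightarrow> real \<Rightarrow> (real \<Rightarrow> real) \<Rightarrow> real \<Rightarrow> real" where
  "conf_deriv \<alpha> t0 f t =
     (if t = t0 then Lim (at_right t0) (\<lambda>s. Lim (at 0) (conf_quot \<alpha> t0 f s))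
      else Lim (at 0) (conf_quot \<alpha> t0 f t))"

definition conf_differentiable :: "real \<Rightarrow> real \<Rightarrow> (real \<Rightarrow> real) \<Rightarrow> real \<Rightarrow> bool" where
  "conf_differentiable \<alpha> t0 f t \<longleftrightarrow>
     (if t = t0 then
        (\<forall>\<^sub>F s in at_right t0. \<exists>L. (conf_quot \<alpha> t0 f s \<longlongrightarrow> L) (at 0)) \<and>
        (\<exists>L. (conf_deriv \<alpha> t0 f \<longlongrightarrow> L) (at_right t0))
      else (\<exists>L. (conf_quot \<alpha> t0 f t \<longlongrightarrow> L) (at 0)))"

definition conf_iter :: "real \<Rightarrow> real \<Rightarrow> nat \<Rightarrow> (real \<Rightarrow> real) \<Rightarrow> real \<Rightarrow> real" where
  "conf_iter \<alpha> t0 k f = (conf_deriv \<alpha> t0 ^^ k) f"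

definition inf_conf_differentiable_on ::
    "real \<Rightarrow> real \<Rightarrow> (real \<Rightarrow> real) \<Rightarrow> real set \<Rightarrow> bool" where
  "inf_conf_differentiable_on \<alpha> t0 f S \<longleftrightarrow>
     (\<forall>k. \<forall>t\<in>S. conf_differentiable \<alpha> t0 (conf_iter \<alpha> t0 k f) t)"

definition frac_term :: "real \<Rightarrow> real \<Rightarrow> (real \<Rightarrow> real) \<Rightarrow> real \<Rightarrow> nat \<Rightarrow> real" where
  "frac_term \<alpha> t0 f t k =
     conf_iter \<alpha> t0 k f t0 * (t - t0) powr (real k * \<alpha>) / (\<alpha> ^ k * fact k)"

definition frac_remainder :: "real \<Rightarrow> real \<Rightarrow> (real \<Rightarrow> real) \<Rightarrow> nat \<Rightarrow> real \<Rightarrow> real" where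
  "frac_remainder \<alpha> t0 f n t = (\<Sum>k. frac_term \<alpha> t0 f t (k + (n + 1)))"

end

theory Submission
  imports Defs
begin

text \<open>
  For \<open>s > t0\<close>, conformable differentiability is ordinary differentiability, and the iterates
  \<open>g\<^sub>k\<close> satisfy \<open>g\<^sub>k' = w g\<^sub>k\<^sub>+\<^sub>1\<close> with weight \<open>w s = (s - t0) powr (\<alpha> - 1)\<close>. The fractional monomials
  \<open>B\<^sub>k s = (s - t0) powr (k \<alpha>) / (\<alpha>\<^sup>k k!)\<close> obey the mirrored recursion
  \<open>B\<^sub>k\<^sub>+\<^sub>1' = w B\<^sub>k\<close>, so Taylor's estimate follows by induction on its order, comparing
  derivatives at each step. The boundary values at \<open>t0\<close> are right limits: for \<open>k \<ge> 1\<close> by the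
  definition of the derivative at \<open>t0\<close>, and for \<open>f\<close> itself because the series is a power series
  in \<open>(t - t0) powr \<alpha>\<close> and hence continuous there.
\<close>

text \<open>Since \<open>F\<close> is nondecreasing on the open interval, \<open>F t\<close> bounds
  \<open>F s\<close> for every \<open>s\<close> between \<open>a\<close> and \<open>t\<close>, and
  the bound survives the right limit. Boundary data enter as this limit, so the value
  \<open>F a\<close> may be arbitrary.\<close>

lemma nonneg_of_deriv_nonneg_at_right:
  fixes F F' :: "real \<Rightarrow> real"
  assumes deriv: "\<And>s. a < s \<Longrightarrow> s < b \<Longrightarrow> (F has_real_derivative F' s) (at s)"
    and nonneg: "\<And>s. a < s \<Longrightarrow> s < b \<Longrightarrow> 0 \<le> F' s"
    and lim: "(F \<longlongrightarrow> 0) (at_right a)"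
    and t: "a < t" "t < b"
  shows "0 \<le> F t"
proof (rule tendsto_upperbound[OF lim])
  have "F s \<le> F t" if "a < s" "s < t" for s
  proof (rule DERIV_nonneg_imp_nondecreasing[where f = F])
    show "s \<le> t" using that by simp
    show "\<exists>y. (F has_real_derivative y) (at x) \<and> 0 \<le> y" if "s \<le> x" "x \<le> t" for x
      using deriv[of x] nonneg[of x] that \<open>a < s\<close> t by force
  qed
  then show "\<forall>\<^sub>F s in at_right a. F s \<le> F t"
    unfolding eventually_at_right_field using t by blast
qed simp

text \<open>Both \<open>E - D\<close> and \<open>E + D\<close> have nonnegative derivative and right
  limit 0, so the preceding lemma applies to each.\<close>

lemma abs_le_of_abs_deriv_le_at_right:
  fixes D D' E E' :: "real \<Rightarrow> real"
  assumes D: "\<And>s. a < s \<Longrightarrow> s < b \<Longrightarrow> (D has_real_derivative D' s) (at s)"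
    and E: "\<And>s. a < s \<Longrightarrow> s < b \<Longrightarrow> (E has_real_derivative E' s) (at s)"
    and le: "\<And>s. a < s \<Longrightarrow> s < b \<Longrightarrow> \<bar>D' s\<bar> \<le> E' s"
    and D0: "(D \<longlongrightarrow> 0) (at_right a)" and E0: "(E \<longlongrightarrow> 0) (at_right a)"
    and t: "a < t" "t < b"
  shows "\<bar>D t\<bar> \<le> E t"
proof -
  have "0 \<le> E t - D t"
  proof (rule nonneg_of_deriv_nonneg_at_right[where F = "\<lambda>s. E s - D s"])
    show "((\<lambda>s. E s - D s) has_real_derivative E' s - D' s) (at s)" if "a < s" "s < b" for s
      using that by (intro DERIV_diff D E)
    show "0 \<le> E' s - D' s" if "a < s" "s < b" for s
      using le[OF that] by linarith
    show "((\<lambda>s. E s - D s) \<longlongrightarrow> 0) (at_right a)"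
      using tendsto_diff[OF E0 D0] by simp
  qed (fact t)+
  moreover have "0 \<le> E t + D t"
  proof (rule nonneg_of_deriv_nonneg_at_right[where F = "\<lambda>s. E s + D s"])
    show "((\<lambda>s. E s + D s) has_real_derivative E' s + D' s) (at s)" if "a < s" "s < b" for s
      using that by (intro DERIV_add D E)
    show "0 \<le> E' s + D' s" if "a < s" "s < b" for s
      using le[OF that] by linarith
    show "((\<lambda>s. E s + D s) \<longlongrightarrow> 0) (at_right a)"
      using tendsto_add[OF E0 D0] by simp
  qed (fact t)+
  ultimately show ?thesis by linarith
qed

text \<open>With \<open>w = 1\<close> and \<open>B k s = (s - a) ^ k / fact k\<close> this is the
  classical Taylor estimate. The induction generalises over \<open>g\<close> and \<open>c\<close>,
  because its step uses the shifted sequences; \<open>B\<close>, \<open>w\<close> and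
  \<open>M\<close> stay fixed.\<close>

lemma weighted_taylor_bound:
  fixes g B :: "nat \<Rightarrow> real \<Rightarrow> real" and w :: "real \<Rightarrow> real" and c :: "nat \<Rightarrow> real"
  assumes g: "\<And>k s. a < s \<Longrightarrow> s < b \<Longrightarrow> (g k has_real_derivative w s * g (Suc k) s) (at s)"
    and g0: "\<And>k. (g k \<longlongrightarrow> c k) (at_right a)"
    and B: "\<And>k s. a < s \<Longrightarrow> s < b \<Longrightarrow> (B (Suc k) has_real_derivative w s * B k s) (at s)"
    and B0: "\<And>k. (B (Suc k) \<longlongrightarrow> 0) (at_right a)"
    and B1: "\<And>s. a < s \<Longrightarrow> B 0 s = 1"
    and w: "\<And>s. a < s \<Longrightarrow> s < b \<Longrightarrow> 0 \<le> w s"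
    and M: "\<And>s. a < s \<Longrightarrow> s < b \<Longrightarrow> \<bar>g m s\<bar> \<le> M"
    and t: "a < t" "t < b"
  shows "\<bar>g 0 t - (\<Sum>k<m. c k * B k t)\<bar> \<le> M * B m t"
  using g g0 M t
proof (induction m arbitrary: g c t)
  case 0
  then show ?case by (simp add: B1)
next
  case (Suc m)
  have IH: "\<bar>g (Suc 0) s - (\<Sum>k<m. c (Suc k) * B k s)\<bar> \<le> M * B m s" if "a < s" "s < b" for s
    by (rule Suc.IH[of "\<lambda>k. g (Suc k)" "\<lambda>k. c (Suc k)"]) (use Suc.prems that in auto)
  \<comment> \<open>The order \<open>Suc m\<close> remainder with its constant term written as
    \<open>c 0\<close>. Differentiation lowers each \<open>B (Suc k)\<close> to \<open>B k\<close>,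
    leaving \<open>w\<close> times the order \<open>m\<close> remainder of the shifted sequence,
    which \<open>IH\<close> controls.\<close>
  let ?D = "\<lambda>s. (g 0 s - c 0) - (\<Sum>k<m. c (Suc k) * B (Suc k) s)"
  have "\<bar>?D t\<bar> \<le> M * B (Suc m) t"
  proof (rule abs_le_of_abs_deriv_le_at_right[where D = ?D and E = "\<lambda>s. M * B (Suc m) s"])
    fix s assume s: "a < s" "s < b"
    let ?r = "g (Suc 0) s - (\<Sum>k<m. c (Suc k) * B k s)"
    show "(?D has_real_derivative w s * ?r) (at s)"
      by (rule derivative_eq_intros DERIV_sum Suc.prems(1) B s refl)+
        (simp add: sum_distrib_left algebra_simps)
    show "((\<lambda>s. M * B (Suc m) s) has_real_derivative w s * (M * B m s)) (at s)"
      by (rule derivative_eq_intros B s refl)+ simp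
    show "\<bar>w s * ?r\<bar> \<le> w s * (M * B m s)"
      using IH[OF s] w[OF s] by (simp add: abs_mult mult_left_mono)
  next
    have "(?D \<longlongrightarrow> (c 0 - c 0) - (\<Sum>k<m. c (Suc k) * 0)) (at_right a)"
      by (intro tendsto_intros Suc.prems(2) B0)
    then show "(?D \<longlongrightarrow> 0) (at_right a)" by simp
    show "((\<lambda>s. M * B (Suc m) s) \<longlongrightarrow> 0) (at_right a)"
      using tendsto_mult_right_zero[OF B0] .
  qed (fact Suc.prems)+
  then show ?case
    unfolding sum.lessThan_Suc_shift using B1[OF \<open>a < t\<close>] by (simp add: algebra_simps)
qed

text \<open>Substituting \<open>h = \<epsilon> * c\<close> with
  \<open>c = (s - t0) powr (1 - \<alpha>) > 0\<close> turns the conformable quotient into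
  \<open>c\<close> times the ordinary one; the weight is \<open>1 / c\<close>.\<close>

lemma conf_quot_limit_imp_DERIV:
  assumes "t0 < s" and lim: "(conf_quot \<alpha> t0 f s \<longlongrightarrow> L) (at 0)"
  shows "(f has_real_derivative (s - t0) powr (\<alpha> - 1) * L) (at s)"
proof -
  define c where "c = (s - t0) powr (1 - \<alpha>)"
  have c: "c > 0" using assms(1) by (simp add: c_def)
  have "filterlim (\<lambda>h. h / c) (at 0) (at 0)"
    unfolding filterlim_at using c
    by (auto intro!: tendsto_eq_intros simp: eventually_at_filter)
  from filterlim_compose[OF lim this]
  have "((\<lambda>h. conf_quot \<alpha> t0 f s (h / c) / c) \<longlongrightarrow> L / c) (at 0)"
    using c by (intro tendsto_divide) auto
  moreover have "conf_quot \<alpha> t0 f s (h / c) / c = (f (s + h) - f s) / h" for h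
    using c by (simp add: conf_quot_def c_def[symmetric])
  moreover have "L / c = (s - t0) powr (\<alpha> - 1) * L"
    using powr_minus_divide[of "s - t0" "1 - \<alpha>"] by (simp add: c_def)
  ultimately show ?thesis by (simp add: DERIV_def)
qed

lemma conf_differentiable_imp_DERIV:
  assumes "t0 < s" "conf_differentiable \<alpha> t0 f s"
  shows "(f has_real_derivative (s - t0) powr (\<alpha> - 1) * conf_deriv \<alpha> t0 f s) (at s)"
proof -
  obtain L where L: "(conf_quot \<alpha> t0 f s \<longlongrightarrow> L) (at 0)"
    using assms by (auto simp: conf_differentiable_def)
  moreover have "conf_deriv \<alpha> t0 f s = L"
    using assms(1) tendsto_Lim[OF _ L] by (simp add: conf_deriv_def)
  ultimately show ?thesis using conf_quot_limit_imp_DERIV[OF assms(1)] by simp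
qed

lemma conf_deriv_tendsto_at_right:
  assumes "conf_differentiable \<alpha> t0 f t0"
  shows "(conf_deriv \<alpha> t0 f \<longlongrightarrow> conf_deriv \<alpha> t0 f t0) (at_right t0)"
proof -
  obtain L where L: "(conf_deriv \<alpha> t0 f \<longlongrightarrow> L) (at_right t0)"
    using assms by (auto simp: conf_differentiable_def)
  \<comment> \<open>The filter \<open>at_right t0\<close> excludes \<open>t0\<close>, so only the
    second branch of \<open>conf_deriv\<close> matters.\<close>
  have "\<forall>\<^sub>F s in at_right t0. conf_deriv \<alpha> t0 f s = Lim (at 0) (conf_quot \<alpha> t0 f s)"
    by (auto simp: eventually_at_filter conf_deriv_def)
  with L have "((\<lambda>s. Lim (at 0) (conf_quot \<alpha> t0 f s)) \<longlongrightarrow> L) (at_right t0)"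
    by (rule Lim_transform_eventually)
  then have "conf_deriv \<alpha> t0 f t0 = L"
    using tendsto_Lim[OF trivial_limit_at_right_real] by (simp add: conf_deriv_def)
  with L show ?thesis by simp
qed

lemma tendsto_powr_at_right_zero:
  fixes p t0 :: real
  assumes "0 < p"
  shows "((\<lambda>s. (s - t0) powr p) \<longlongrightarrow> 0) (at_right t0)"
proof -
  have "((\<lambda>s. s - t0) \<longlongrightarrow> 0) (at_right t0)"
    by (auto intro!: tendsto_eq_intros)
  then show ?thesis
    using assms by (intro tendsto_zero_powrI[where b = p]) (auto simp: eventually_at_filter)
qed

text \<open>Differentiability at \<open>t0\<close> constrains only the derivative to the right of
  \<open>t0\<close>; the series is what ties \<open>f t0\<close> to nearby values of
  \<open>f\<close>.\<close>

lemma tendsto_at_right_of_frac_series: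
  fixes \<alpha> t0 R :: real and f :: "real \<Rightarrow> real"
  assumes \<alpha>: "0 < \<alpha>" and R: "0 < R"
    and series: "\<And>t. t \<in> {t0<..<t0 + R} \<Longrightarrow> frac_term \<alpha> t0 f t sums f t"
  shows "(f \<longlongrightarrow> f t0) (at_right t0)"
proof -
  define a where "a k = conf_iter \<alpha> t0 k f t0 / (\<alpha> ^ k * fact k)" for k
  define x where "x s = (s - t0) powr \<alpha>" for s
  have x: "(x \<longlongrightarrow> 0) (at_right t0)"
    unfolding x_def by (rule tendsto_powr_at_right_zero[OF \<alpha>])
  have sums: "(\<lambda>k. a k * x s ^ k) sums f s" if s: "t0 < s" "s < t0 + R" for s
  proof -
    have "frac_term \<alpha> t0 f s k = a k * x s ^ k" for k
      using s by (simp add: frac_term_def a_def x_def powr_power mult.commute)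
    then show ?thesis using series[of s] s by (auto simp: fun_eq_iff cong: sums_cong)
  qed
  \<comment> \<open>Convergence at one positive argument makes 0 interior to the disc of
    convergence; the midpoint of the interval supplies it.\<close>
  define K where "K = x (t0 + R / 2)"
  have "K > 0" using R by (simp add: K_def x_def)
  moreover have "summable (\<lambda>k. a k * K ^ k)"
    unfolding K_def using sums[of "t0 + R / 2"] R by (simp add: sums_iff)
  ultimately have "isCont (\<lambda>x. \<Sum>k. a k * x ^ k) 0"
    by (intro isCont_powser) auto
  from isCont_tendsto_compose[OF this x]
  have "((\<lambda>s. \<Sum>k. a k * x s ^ k) \<longlongrightarrow> a 0) (at_right t0)"
    by (simp add: powser_zero)
  moreover have "\<forall>\<^sub>F s in at_right t0. (\<Sum>k. a k * x s ^ k) = f s"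
    unfolding eventually_at_right_field
    using sums R by (intro exI[of _ "t0 + R"]) (auto simp: sums_iff)
  ultimately have "(f \<longlongrightarrow> a 0) (at_right t0)"
    by (rule Lim_transform_eventually)
  then show ?thesis by (simp add: a_def conf_iter_def)
qed

text \<open>The power rule brings down \<open>(k + 1) * \<alpha>\<close>, exactly the factor by
  which the two denominators differ, and the new exponent splits as
  \<open>(\<alpha> - 1) + k * \<alpha>\<close>.\<close>

lemma DERIV_frac_monomial:
  fixes \<alpha> t0 s :: real
  assumes "0 < \<alpha>" "t0 < s"
  shows "((\<lambda>s. (s - t0) powr (real (Suc k) * \<alpha>) / (\<alpha> ^ Suc k * fact (Suc k)))
    has_real_derivative
      (s - t0) powr (\<alpha> - 1) * ((s - t0) powr (real k * \<alpha>) / (\<alpha> ^ k * fact k))) (at s)"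
proof -
  define p where "p = real (Suc k) * \<alpha>"
  have "((\<lambda>s. (s - t0) powr p / (\<alpha> ^ Suc k * fact (Suc k)))
      has_real_derivative p * (s - t0) powr (p - 1) / (\<alpha> ^ Suc k * fact (Suc k))) (at s)"
    using assms by (auto intro!: derivative_eq_intros)
  moreover have "(s - t0) powr (p - 1) = (s - t0) powr (\<alpha> - 1) * (s - t0) powr (real k * \<alpha>)"
    by (simp add: powr_add[symmetric] p_def algebra_simps)
  moreover have "p * (x * y) / (\<alpha> ^ Suc k * fact (Suc k)) = x * (y / (\<alpha> ^ k * fact k))" for x y
  proof -
    have "p * (x * y) / (\<alpha> ^ Suc k * fact (Suc k)) =
        (real (Suc k) * \<alpha>) * (x * y) / ((real (Suc k) * \<alpha>) * (\<alpha> ^ k * fact k))"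
      by (simp add: p_def mult_ac del: of_nat_Suc)
    also have "\<dots> = x * (y / (\<alpha> ^ k * fact k))"
      using assms by (subst mult_divide_mult_cancel_left) auto
    finally show ?thesis .
  qed
  ultimately show ?thesis
    unfolding p_def[symmetric] by (simp only:)
qed

theorem proposition4p2:
  fixes \<alpha> t0 R M :: real and f :: "real \<Rightarrow> real" and n :: nat
  assumes "0 < \<alpha>" and "\<alpha> \<le> 1" and "0 < R"
    and "inf_conf_differentiable_on \<alpha> t0 f {t0..<t0 + R}"
    and "\<And>t. t \<in> {t0<..<t0 + R} \<Longrightarrow> frac_term \<alpha> t0 f t sums f t"
    and "0 < M"
    and "\<And>t. t \<in> {t0<..<t0 + R} \<Longrightarrow> \<bar>conf_iter \<alpha> t0 (n + 1) f t\<bar> \<le> M"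
  shows "\<forall>t\<in>{t0<..<t0 + R}.
           (\<lambda>k. frac_term \<alpha> t0 f t (k + (n + 1))) sums frac_remainder \<alpha> t0 f n t \<and>
           frac_remainder \<alpha> t0 f n t = f t - (\<Sum>k\<le>n. frac_term \<alpha> t0 f t k) \<and>
           \<bar>frac_remainder \<alpha> t0 f n t\<bar>
             \<le> M / (\<alpha> ^ (n + 1) * fact (n + 1)) * (t - t0) powr (\<alpha> * real (n + 1))"
proof
  fix t assume "t \<in> {t0<..<t0 + R}"
  then have t: "t0 < t" "t < t0 + R" by auto
  define g where "g k = conf_iter \<alpha> t0 k f" for k
  define B where "B k s = (s - t0) powr (real k * \<alpha>) / (\<alpha> ^ k * fact k)" for k s
  have g_Suc: "g (Suc k) = conf_deriv \<alpha> t0 (g k)" for k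
    by (simp add: g_def conf_iter_def)
  have diff: "conf_differentiable \<alpha> t0 (g k) s" if "t0 \<le> s" "s < t0 + R" for k s
    using assms(4) that by (auto simp: g_def inf_conf_differentiable_on_def)
  have g_lim: "(g k \<longlongrightarrow> g k t0) (at_right t0)" for k
  proof (cases k)
    case 0
    then show ?thesis
      using tendsto_at_right_of_frac_series[OF assms(1,3,5)] by (simp add: g_def conf_iter_def)
  next
    case (Suc j)
    then show ?thesis
      unfolding Suc g_Suc by (intro conf_deriv_tendsto_at_right diff) (use assms(3) in auto)
  qed
  have B_lim: "(B (Suc k) \<longlongrightarrow> 0) (at_right t0)" for k
    unfolding B_def using assms(1)
    by (intro tendsto_divide_zero tendsto_powr_at_right_zero) simp
  \<comment> \<open>The order is \<open>n + 1\<close>: the terms up to \<open>n\<close> are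
    subtracted, and \<open>M\<close> bounds the iterate of index \<open>n + 1\<close>.\<close>
  have "\<bar>g 0 t - (\<Sum>k<n + 1. g k t0 * B k t)\<bar> \<le> M * B (n + 1) t"
  proof (rule weighted_taylor_bound[where w = "\<lambda>s. (s - t0) powr (\<alpha> - 1)"
        and a = t0 and b = "t0 + R"])
    show "(g k has_real_derivative (s - t0) powr (\<alpha> - 1) * g (Suc k) s) (at s)"
      if "t0 < s" "s < t0 + R" for k s
      unfolding g_Suc using that by (intro conf_differentiable_imp_DERIV diff) auto
    show "(B (Suc k) has_real_derivative (s - t0) powr (\<alpha> - 1) * B k s) (at s)"
      if "t0 < s" for k s
      unfolding B_def by (rule DERIV_frac_monomial[OF assms(1) that])
    show "(g k \<longlongrightarrow> g k t0) (at_right t0)" "(B (Suc k) \<longlongrightarrow> 0) (at_right t0)" for k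
      by (fact g_lim B_lim)+
    show "\<bar>g (n + 1) s\<bar> \<le> M" if "t0 < s" "s < t0 + R" for s
      using assms(7)[of s] that by (simp add: g_def)
  \<comment> \<open>Here \<open>B 0 s = 1\<close> relies on \<open>s > t0\<close>, since
    \<open>0 powr 0\<close> is 0 by convention.\<close>
  qed (use t in \<open>auto simp: B_def\<close>)
  moreover have "(\<Sum>k<n + 1. g k t0 * B k t) = (\<Sum>k\<le>n. frac_term \<alpha> t0 f t k)"
    by (simp add: frac_term_def g_def B_def lessThan_Suc_atMost)
  moreover have "g 0 t = f t" by (simp add: g_def conf_iter_def)
  ultimately have bound: "\<bar>f t - (\<Sum>k\<le>n. frac_term \<alpha> t0 f t k)\<bar>
      \<le> M / (\<alpha> ^ (n + 1) * fact (n + 1)) * (t - t0) powr (\<alpha> * real (n + 1))"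
    by (simp add: B_def mult.commute)
  \<comment> \<open>Dropping the first \<open>n + 1\<close> terms of the series identifies its tail
    with the difference just bounded.\<close>
  have sums: "(\<lambda>k. frac_term \<alpha> t0 f t (k + (n + 1))) sums
      (f t - (\<Sum>k\<le>n. frac_term \<alpha> t0 f t k))"
    using sums_split_initial_segment[OF assms(5), of t "n + 1"] t
    by (simp add: lessThan_Suc_atMost)
  then have "frac_remainder \<alpha> t0 f n t = f t - (\<Sum>k\<le>n. frac_term \<alpha> t0 f t k)"
    by (simp add: frac_remainder_def sums_iff)
  with sums bound show "(\<lambda>k. frac_term \<alpha> t0 f t (k + (n + 1))) sums frac_remainder \<alpha> t0 f n t \<and>
           frac_remainder \<alpha> t0 f n t = f t - (\<Sum>k\<le>n. frac_term \<alpha> t0 f t k) \<and>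
           \<bar>frac_remainder \<alpha> t0 f n t\<bar>
             \<le> M / (\<alpha> ^ (n + 1) * fact (n + 1)) * (t - t0) powr (\<alpha> * real (n + 1))"
    by simp
qed

end
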